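(* Consider a linear passive RLC network in impedance, admittance or hybrid form, with $A_{22}$ nonsingular (index-1 case). Then the reciprocity of the descriptor system is preserved after applying positive real balanced truncation. That is, the reduced-order transfer matrix $$\tilde G(s)=\tilde C_1S_1\left(sS_1-\tilde A_s\right)^{-1}\tilde B_1+\hat D_0$$ constructed in the context is symmetric for the impedance form and for the admittance form, and is block skew symmetric for the hybrid form.
   Context: All matrices are real. An $m\times m$ matrix ($m$ even) $H=\begin{bmatrix}H_{11}&H_{12}\\ H_{21}&H_{22}\end{bmatrix}$ with $m/2\times m/2$ blocks is called block skew symmetric if $H_{11}=H_{11}^T$, $H_{22}=H_{22}^T$, $H_{12}=-H_{21}^T$. Reciprocity means that the transfer matrix is symmetric (impedance, admittance) or block skew symmetric (hybrid). Network. Consider the descriptor system $E_0\,\frac{dx}{dt}=A_0x+B_0u$, $z=C_0x$, with $E_0,A_0\in\mathbb{R}^{n,n}$, $B_0\in\mathbb{R}^{n,m}$, $C_0\in\mathbb{R}^{m,n}$, $sE_0-A_0$ a regular pencil. Let $\mathcal{G},\mathcal{L},\mathcal{C}$ be the conductance, inductance and capacitance matrices (symmetric positive semidefinite), and $A_{\mathcal G},A_{\mathcal C},A_{\mathcal L},A_{\mathcal I},A_{\mathcal V}$ the incidence matrices to conductors, capacitors, inductors, independent current sources and independent voltage sources, of compatible sizes. $I_k$ is the $k\times k$ identity. Impedance form: $$E_0=\begin{bmatrix}A_{\mathcal C}\mathcal{C}A_{\mathcal C}^T&0\\ 0&-\mathcal{L}\end{bmatrix},\quad A_0=\begin{bmatrix}-A_{\mathcal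 G}\mathcal{G}A_{\mathcal G}^T&-A_{\mathcal L}\\ -A_{\mathcal L}^T&0\end{bmatrix},\quad B_0=\begin{bmatrix}-A_{\mathcal I}\\ 0\end{bmatrix},\quad C_0=B_0^T.$$ For the admittance and hybrid forms: $$E_0=\begin{bmatrix}A_{\mathcal C}\mathcal{C}A_{\mathcal C}^T&0&0\\ 0&-\mathcal{L}&0\\ 0&0&0\end{bmatrix},\quad A_0=\begin{bmatrix}-A_{\mathcal G}\mathcal{G}A_{\mathcal G}^T&-A_{\mathcal L}&-A_{\mathcal V}\\ -A_{\mathcal L}^T&0&0\\ -A_{\mathcal V}^T&0&0\end{bmatrix}.$$ Admittance form: $B_0=\begin{bmatrix}0\\ 0\\ I_m\end{bmatrix}$, $C_0=\begin{bmatrix}0&0&-I_m\end{bmatrix}$. Hybrid form ($m$ even): $B_0=\begin{bmatrix}-A_{\mathcal I}&0\\ 0&0\\ 0&I_{m/2}\end{bmatrix}$, $C_0=\begin{bmatrix}-A_{\mathcal I}^T&0&0\\ 0&0&-I_{m/2}\end{bmatrix}$. State equation. Let $r_1,r_2$ be the ranks of $A_{\mathcal C}\mathcal{C}A_{\mathcal C}^T$ and $\mathcal{L}$, $r=r_1+r_2$, and $I'_r=\mathrm{diag}(I_{r_1},-I_{r_2})$. By LDL factorization there is a nonsingular $V$ with $E_0=V\begin{bmatrix}I'_r&0\\ 0&0\end{bmatrix}V^T$. Partition conformably $$V^{-1}A_0V^{-T}=\begin{bmatrix}A_{11}&A_{12}\\ A_{21}&A_{22}\end{bmatrix},\quad V^{-1}B_0=\begin{bmatrix}B_1\\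 B_2\end{bmatrix},\quad C_0V^{-T}=\begin{bmatrix}C_1&C_2\end{bmatrix}.$$ Assume $A_{22}$ is nonsingular and set $A_s=A_{11}-A_{12}A_{22}^{-1}A_{21}$, $$\hat A_0=I'_rA_s,\quad \hat B_0=I'_r(B_1-A_{12}A_{22}^{-1}B_2),\quad \hat C_0=C_1-C_2A_{22}^{-1}A_{21},\quad \hat D_0=-C_2A_{22}^{-1}B_2.$$ It is assumed that $\hat D_0+\hat D_0^T$ is positive definite; let $DD^T=(\hat D_0+\hat D_0^T)^{-1}$, $B=\hat B_0D$, $C=D^T\hat C_0$, $A=\hat A_0-BC$. Positive real balanced truncation. Let $X$ be a symmetric positive semidefinite solution of $A^TX+XA+XBB^TX+C^TC=0$, factored as $X=QQ^T$. Take an eigenvalue decomposition $Q^TI'_rQ=U\Sigma U^T=U|\Sigma|SU^T$ with $U$ orthogonal, $\Sigma$ diagonal with diagonal entries in descending order of absolute value, and $S$ the diagonal matrix of the signs of the entries of $\Sigma$. Partition $\Sigma=\mathrm{diag}(\Sigma_1,\Sigma_2)$, $S=\mathrm{diag}(S_1,S_2)$, $U=\begin{bmatrix}U_1&U_2\end{bmatrix}$ conformably, where the retained values, in $\Sigma_1$, are nonzero. Define $$\tilde A_s=|\Sigma_1|^{-1/2}U_1^TQ^TI'_rA_sI'_rQU_1|\Sigma_1|^{-1/2},\quad \tilde B_1=|\Sigma_1|^{-1/2}U_1^TQ^T\hat B_0,\quad \tilde C_1=\hat C_0I'_rQU_1S_1|\Sigma_1|^{-1/2}.$$ The reduced-order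 model is $(\tilde A_sS_1,\tilde B_1,\tilde C_1,\hat D_0)$, whose transfer matrix is $\tilde G(s)$ as in the claim (a rational matrix function of $s$). *)

theory Defs
  imports
    "Jordan_Normal_Form.Gauss_Jordan_Elimination"
    "Jordan_Normal_Form.DL_Rank"
    "HOL-Computational_Algebra.Polynomial_Factorial"
begin

text \<open>Matrices carry their dimensions as data, so every block size may be zero: a network
  without inductors, for instance, has a \<open>0 \<times> 0\<close> inductance matrix.\<close>

definition append_cols :: "'a :: zero mat \<Rightarrow> 'a mat \<Rightarrow> 'a mat" (infixr \<open>@\<^sub>c\<close> 65) where
  "A @\<^sub>c B = four_block_mat A B (0\<^sub>m 0 (dim_col A)) (0\<^sub>m 0 (dim_col B))"

text \<open>Unspecified on singular matrices.\<close>

definition inv_mat :: "'a :: field mat \<Rightarrow> 'a mat" where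
  "inv_mat A = the (mat_inverse A)"

definition symmetric_mat :: "'a mat \<Rightarrow> bool" where
  "symmetric_mat H \<longleftrightarrow> H\<^sup>T = H"

definition block_skew_symmetric_mat :: "'a :: uminus mat \<Rightarrow> bool" where
  "block_skew_symmetric_mat H \<longleftrightarrow> square_mat H \<and> even (dim_row H) \<and>
     (case split_block H (dim_row H div 2) (dim_row H div 2) of
        (H11, H12, H21, H22) \<Rightarrow> H11 = H11\<^sup>T \<and> H22 = H22\<^sup>T \<and> H12 = - H21\<^sup>T)"

definition psd_mat :: "real mat \<Rightarrow> bool" where
  "psd_mat H \<longleftrightarrow> symmetric_mat H \<and>
     (\<forall>v \<in> carrier_vec (dim_row H). v \<bullet> (H *\<^sub>v v) \<ge> 0)"

definition pd_mat :: "real mat \<Rightarrow> bool" where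
  "pd_mat H \<longleftrightarrow> symmetric_mat H \<and>
     (\<forall>v \<in> carrier_vec (dim_row H). v \<noteq> 0\<^sub>v (dim_row H) \<longrightarrow> v \<bullet> (H *\<^sub>v v) > 0)"

text \<open>Node-branch incidence matrix of a directed multigraph: branch \<open>j\<close> leaves node \<open>src j\<close>
  and enters node \<open>tgt j\<close>. An index \<open>\<ge> nn\<close> stands for the grounded (reference) node, whose
  row is omitted; a full incidence matrix is the case in which no branch meets that node.\<close>

definition incidence_mat :: "nat \<Rightarrow> nat \<Rightarrow> real mat \<Rightarrow> bool" where
  "incidence_mat nn nb M \<longleftrightarrow> M \<in> carrier_mat nn nb \<and>
     (\<exists>src tgt :: nat \<Rightarrow> nat. \<forall>i<nn. \<forall>j<nb.
        M $$ (i, j) = (if src j = i then 1 else 0) - (if tgt j = i then 1 else 0))"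

record rlc =
  nodes :: nat
  conductance :: "real mat"
  inductance :: "real mat"
  capacitance :: "real mat"
  inc_G :: "real mat"
  inc_L :: "real mat"
  inc_C :: "real mat"
  inc_I :: "real mat"
  inc_V :: "real mat"

datatype port_form = Impedance | Admittance | Hybrid

text \<open>\<open>m\<close> is the number of ports, all of them current sources in the impedance form, all of
  them voltage sources in the admittance form, and half of each kind in the hybrid form.\<close>

definition passive_rlc_network :: "port_form \<Rightarrow> nat \<Rightarrow> rlc \<Rightarrow> bool" where
  "passive_rlc_network form m N \<longleftrightarrow>
     psd_mat (conductance N) \<and> psd_mat (inductance N) \<and> psd_mat (capacitance N) \<and>
     incidence_mat (nodes N) (dim_row (conductance N)) (inc_G N) \<and>
     incidence_mat (nodes N) (dim_row (inductance N)) (inc_L N) \<and>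
     incidence_mat (nodes N) (dim_row (capacitance N)) (inc_C N) \<and>
     (case form of
        Impedance \<Rightarrow> incidence_mat (nodes N) m (inc_I N) \<and> incidence_mat (nodes N) 0 (inc_V N)
      | Admittance \<Rightarrow> incidence_mat (nodes N) 0 (inc_I N) \<and> incidence_mat (nodes N) m (inc_V N)
      | Hybrid \<Rightarrow> even m \<and> incidence_mat (nodes N) (m div 2) (inc_I N) \<and>
          incidence_mat (nodes N) (m div 2) (inc_V N))"

definition nodal_capacitance :: "rlc \<Rightarrow> real mat" where
  "nodal_capacitance N = inc_C N * capacitance N * (inc_C N)\<^sup>T"

definition nodal_conductance :: "rlc \<Rightarrow> real mat" where
  "nodal_conductance N = inc_G N * conductance N * (inc_G N)\<^sup>T"

definition rlc_E :: "rlc \<Rightarrow> real mat" where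
  "rlc_E N = (let k = nodes N; l = dim_row (inductance N) in
     four_block_mat (nodal_capacitance N) (0\<^sub>m k l) (0\<^sub>m l k) (- inductance N))"

definition rlc_A :: "rlc \<Rightarrow> real mat" where
  "rlc_A N = (let l = dim_row (inductance N) in
     four_block_mat (- nodal_conductance N) (- inc_L N) (- (inc_L N)\<^sup>T) (0\<^sub>m l l))"

definition rlcv_E :: "rlc \<Rightarrow> real mat" where
  "rlcv_E N = (let kl = nodes N + dim_row (inductance N); v = dim_col (inc_V N) in
     four_block_mat (rlc_E N) (0\<^sub>m kl v) (0\<^sub>m v kl) (0\<^sub>m v v))"

definition rlcv_A :: "rlc \<Rightarrow> real mat" where
  "rlcv_A N = (let l = dim_row (inductance N); v = dim_col (inc_V N) in
     four_block_mat (rlc_A N) (- inc_V N @\<^sub>r 0\<^sub>m l v) (- (inc_V N)\<^sup>T @\<^sub>c 0\<^sub>m v l) (0\<^sub>m v v))"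

fun descr_E :: "port_form \<Rightarrow> rlc \<Rightarrow> real mat" where
  "descr_E Impedance N = rlc_E N"
| "descr_E Admittance N = rlcv_E N"
| "descr_E Hybrid N = rlcv_E N"

fun descr_A :: "port_form \<Rightarrow> rlc \<Rightarrow> real mat" where
  "descr_A Impedance N = rlc_A N"
| "descr_A Admittance N = rlcv_A N"
| "descr_A Hybrid N = rlcv_A N"

fun descr_B :: "port_form \<Rightarrow> nat \<Rightarrow> rlc \<Rightarrow> real mat" where
  "descr_B Impedance m N = - inc_I N @\<^sub>r 0\<^sub>m (dim_row (inductance N)) m"
| "descr_B Admittance m N = 0\<^sub>m (nodes N) m @\<^sub>r 0\<^sub>m (dim_row (inductance N)) m @\<^sub>r 1\<^sub>m m"
| "descr_B Hybrid m N = (let l = dim_row (inductance N); h = m div 2 in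
     (- inc_I N @\<^sub>c 0\<^sub>m (nodes N) h) @\<^sub>r (0\<^sub>m l h @\<^sub>c 0\<^sub>m l h) @\<^sub>r (0\<^sub>m h h @\<^sub>c 1\<^sub>m h))"

fun descr_C :: "port_form \<Rightarrow> nat \<Rightarrow> rlc \<Rightarrow> real mat" where
  "descr_C Impedance m N = (descr_B Impedance m N)\<^sup>T"
| "descr_C Admittance m N =
     0\<^sub>m m (nodes N) @\<^sub>c 0\<^sub>m m (dim_row (inductance N)) @\<^sub>c - 1\<^sub>m m"
| "descr_C Hybrid m N = (let l = dim_row (inductance N); h = m div 2 in
     (- (inc_I N)\<^sup>T @\<^sub>c 0\<^sub>m h l @\<^sub>c 0\<^sub>m h h) @\<^sub>r
     (0\<^sub>m h (nodes N) @\<^sub>c 0\<^sub>m h l @\<^sub>c - 1\<^sub>m h))"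

text \<open>Rational functions of \<open>s\<close> with real coefficients form the field \<^typ>\<open>real poly fract\<close>,
  in which \<open>s\<close> is the class of the polynomial \<open>[:0, 1:]\<close>.\<close>

definition const_ratmat :: "real mat \<Rightarrow> real poly fract mat" where
  "const_ratmat = map_mat (\<lambda>c. to_fract [:c:])"

definition pencil :: "real mat \<Rightarrow> real mat \<Rightarrow> real poly fract mat" where
  "pencil E A = to_fract [:0, 1:] \<cdot>\<^sub>m const_ratmat E - const_ratmat A"

definition regular_pencil :: "real mat \<Rightarrow> real mat \<Rightarrow> bool" where
  "regular_pencil E A \<longleftrightarrow> square_mat E \<and> square_mat A \<and> dim_row E = dim_row A \<and>
     det (pencil E A) \<noteq> 0"

end

theory Submission
  imports Defs "Jordan_Normal_Form.Char_Poly"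
begin

text \<open>
  Reciprocity of a network is a symmetry up to port signs. Let \<open>T\<close> be the diagonal matrix with
  entry \<open>1\<close> at every current port and \<open>- 1\<close> at every voltage port. In each of the three forms
  \<open>A\<^sub>0\<close> is symmetric and \<open>C\<^sub>0 = T B\<^sub>0\<^sup>T\<close> (lemmas \<open>symmetric_descr_A\<close> and \<open>descr_C_eq\<close>), and
  the claim about the reduced transfer matrix \<open>G\<close> says in each form that \<open>T G\<close> is symmetric
  (lemma \<open>reciprocal_if_signed_symmetric\<close>). So it suffices to carry this one structure through
  the construction.

  The coordinate change \<open>V\<close> acts on \<open>A\<^sub>0\<close> by congruence, and it acts on \<open>B\<^sub>0\<close> and \<open>C\<^sub>0\<^sup>T\<close> in the
  same way, so the structure survives. Eliminating the algebraic variables is a Schur complement: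
  with \<open>K = B\<^sub>1 - A\<^sub>1\<^sub>2 A\<^sub>2\<^sub>2\<^sup>-\<^sup>1 B\<^sub>2\<close> the matrix \<open>A\<^sub>s\<close> is symmetric, the new output matrix is
  \<open>T K\<^sup>T\<close>, and \<open>T\<close> times the feedthrough is symmetric (lemma \<open>schur_reduction_signed_symmetric\<close>).
  Truncation projects with \<open>M = Q U\<^sub>1 |\<Sigma>\<^sub>1|\<^sup>-\<^sup>1\<^sup>/\<^sup>2\<close>: the reduced \<open>A\<^sub>s\<close> is the congruence
  \<open>M\<^sup>T I' A\<^sub>s I' M\<close>, and since \<open>S\<^sub>1\<close> commutes with \<open>|\<Sigma>\<^sub>1|\<close> and squares to the identity,
  \<open>C S\<^sub>1 = T B\<^sup>T\<close> for the reduced input and output matrices \<open>B\<close> and \<open>C\<close>.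
  Therefore \<open>T G = B\<^sup>T (s S\<^sub>1 - A)\<^sup>-\<^sup>1 B + T D\<close> is a sum of symmetric matrices
  (lemma \<open>signed_symmetric_transfer\<close>).
  The inverse exists over the field of rational functions: as the retained values are nonzero,
  \<open>S\<^sub>1\<close> is invertible, and \<open>det (s S\<^sub>1 - A)\<close> is up to the factor \<open>det S\<^sub>1\<close> a characteristic
  polynomial (lemma \<open>det_pencil_nonzero\<close>).
\<close>

section \<open>Matrix algebra\<close>

text \<open>The hypotheses of the next two lemmas are equations between dimensions, which the
  simplifier can discharge for compound factors; carrier premises would leave it to guess
  the intermediate dimensions.\<close>

lemma mult_assoc_dim:
  fixes A B C :: "'a :: semiring_0 mat"
  assumes "dim_col A = dim_row B" "dim_col B = dim_row C"
  shows "A * B * C = A * (B * C)"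
  by (rule assoc_mult_mat[of A "dim_row A" "dim_row B" B "dim_row C" C "dim_col C"])
    (use assms in auto)

lemma transpose_mult_dim:
  fixes A B :: "'a :: comm_semiring_0 mat"
  assumes "dim_col A = dim_row B"
  shows "(A * B)\<^sup>T = B\<^sup>T * A\<^sup>T"
  by (rule transpose_mult[of A "dim_row A" "dim_row B" B "dim_col B"]) (use assms in auto)

lemma mat_diag_transpose [simp]: "(mat_diag n f)\<^sup>T = mat_diag n f"
  by (auto simp: mat_diag_def)

lemma dim_mat_diag [simp]: "dim_row (mat_diag n f) = n" "dim_col (mat_diag n f) = n"
  by (auto simp: mat_diag_def)

lemma symmetric_mat_square: "symmetric_mat M \<Longrightarrow> dim_row M = dim_col M"
  unfolding symmetric_mat_def by (metis index_transpose_mat(2))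

lemma symmetric_congruence:
  fixes M K :: "'a :: comm_semiring_0 mat"
  assumes "symmetric_mat M" "dim_col K = dim_row M"
  shows "symmetric_mat (K * M * K\<^sup>T)"
  using assms symmetric_mat_square[OF assms(1)]
  by (simp add: symmetric_mat_def transpose_mult_dim mult_assoc_dim)

text \<open>A nonzero determinant makes the matrix a unit of the matrix ring, so Gauss-Jordan
  elimination succeeds and the value of \<^const>\<open>inv_mat\<close> is specified.\<close>

lemma inv_mat_of_det_nonzero:
  assumes A: "A \<in> carrier_mat n n" and "det A \<noteq> 0"
  shows "inv_mat A \<in> carrier_mat n n" "A * inv_mat A = 1\<^sub>m n" "inv_mat A * A = 1\<^sub>m n"
proof -
  obtain R where "mat_inverse A = Some R"
    using mat_inverse(1)[OF A] det_non_zero_imp_unit[OF assms] by fastforce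
  with mat_inverse(2)[OF A this]
  show "inv_mat A \<in> carrier_mat n n" "A * inv_mat A = 1\<^sub>m n" "inv_mat A * A = 1\<^sub>m n"
    by (auto simp: inv_mat_def)
qed

lemma invertible_mat_det_nonzero:
  fixes A :: "'a :: field mat"
  assumes A: "A \<in> carrier_mat n n" and "invertible_mat A"
  shows "det A \<noteq> 0"
proof -
  from assms obtain R where R: "A * R = 1\<^sub>m n" "R * A = 1\<^sub>m (dim_row R)"
    unfolding invertible_mat_def inverts_mat_def by auto
  from arg_cong[OF R(1), of dim_col] arg_cong[OF R(2), of dim_col] A
  have "R \<in> carrier_mat n n" by auto
  from det_mult[OF A this] R(1) show ?thesis by auto
qed

text \<open>The transpose of the inverse is a left inverse of \<open>A\<^sup>T = A\<close>, and inverses are unique.\<close>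

lemma symmetric_inv_mat:
  assumes A: "A \<in> carrier_mat n n" and d: "det A \<noteq> 0" and s: "symmetric_mat A"
  shows "symmetric_mat (inv_mat A)"
proof -
  note i = inv_mat_of_det_nonzero[OF A d]
  have "(inv_mat A)\<^sup>T * A = (A * inv_mat A)\<^sup>T"
    using i(1) A s by (simp add: transpose_mult_dim symmetric_mat_def)
  hence l: "(inv_mat A)\<^sup>T * A = 1\<^sub>m n" using i by simp
  have "(inv_mat A)\<^sup>T = (inv_mat A)\<^sup>T * (A * inv_mat A)"
    using i(1) unfolding i(2) by simp
  also have "\<dots> = (inv_mat A)\<^sup>T * A * inv_mat A"
    using i(1) A by (simp add: mult_assoc_dim)
  also have "\<dots> = inv_mat A" using i(1) l by simp
  finally show ?thesis by (simp add: symmetric_mat_def)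
qed

lemma four_block_mat_inject:
  assumes eq: "four_block_mat A B C D = four_block_mat A' B' C' D'"
    and "A \<in> carrier_mat a c" "B \<in> carrier_mat a d" "C \<in> carrier_mat b c" "D \<in> carrier_mat b d"
    and "A' \<in> carrier_mat a c" "B' \<in> carrier_mat a d" "C' \<in> carrier_mat b c" "D' \<in> carrier_mat b d"
  shows "A = A'" "B = B'" "C = C'" "D = D'"
proof -
  have e: "four_block_mat A B C D $$ (i, j) = four_block_mat A' B' C' D' $$ (i, j)" for i j
    using eq by simp
  show "A = A'"
  proof (rule eq_matI)
    fix i j assume "i < dim_row A'" "j < dim_col A'"
    thus "A $$ (i, j) = A' $$ (i, j)" using e[of i j] assms(2-) by auto
  qed (use assms in auto)
  show "B = B'"
  proof (rule eq_matI)
    fix i j assume "i < dim_row B'" "j < dim_col B'"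
    thus "B $$ (i, j) = B' $$ (i, j)" using e[of i "c + j"] assms(2-) by auto
  qed (use assms in auto)
  show "C = C'"
  proof (rule eq_matI)
    fix i j assume "i < dim_row C'" "j < dim_col C'"
    thus "C $$ (i, j) = C' $$ (i, j)" using e[of "a + i" j] assms(2-) by auto
  qed (use assms in auto)
  show "D = D'"
  proof (rule eq_matI)
    fix i j assume "i < dim_row D'" "j < dim_col D'"
    thus "D $$ (i, j) = D' $$ (i, j)" using e[of "a + i" "c + j"] assms(2-) by auto
  qed (use assms in auto)
qed

lemma symmetric_four_block_mat_iff:
  assumes c: "A \<in> carrier_mat a a" "B \<in> carrier_mat a b" "C \<in> carrier_mat b a" "D \<in> carrier_mat b b"
  shows "symmetric_mat (four_block_mat A B C D) \<longleftrightarrow> symmetric_mat A \<and> symmetric_mat D \<and> C = B\<^sup>T"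
proof
  assume "symmetric_mat (four_block_mat A B C D)"
  hence "four_block_mat A\<^sup>T C\<^sup>T B\<^sup>T D\<^sup>T = four_block_mat A B C D"
    unfolding symmetric_mat_def transpose_four_block_mat[OF c] .
  from four_block_mat_inject[OF this, of a a b b] c
  show "symmetric_mat A \<and> symmetric_mat D \<and> C = B\<^sup>T" by (auto simp: symmetric_mat_def)
next
  assume "symmetric_mat A \<and> symmetric_mat D \<and> C = B\<^sup>T"
  thus "symmetric_mat (four_block_mat A B C D)"
    unfolding symmetric_mat_def transpose_four_block_mat[OF c] by auto
qed

lemma append_cols_inject:
  assumes "A @\<^sub>c B = A' @\<^sub>c B'"
    and "A \<in> carrier_mat a c" "B \<in> carrier_mat a d" "A' \<in> carrier_mat a c" "B' \<in> carrier_mat a d"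
  shows "A = A'" "B = B'"
  using four_block_mat_inject[OF assms(1)[unfolded append_cols_def], of a c d 0] assms by auto

lemma append_rows_transpose:
  assumes "dim_col A = dim_col B"
  shows "(A @\<^sub>r B)\<^sup>T = A\<^sup>T @\<^sub>c B\<^sup>T"
  by (rule eq_matI) (use assms in \<open>auto simp: append_rows_def append_cols_def\<close>)

lemma mult_append_cols:
  fixes T :: "'a :: semiring_0 mat"
  assumes "dim_col T = dim_row A" "dim_row A = dim_row B"
  shows "T * (A @\<^sub>c B) = (T * A) @\<^sub>c (T * B)"
  by (rule eq_matI) (use assms in \<open>auto simp: append_cols_def scalar_prod_def\<close>)

lemma symmetric_uminus_iff [simp]:
  fixes M :: "'a :: group_add mat"
  shows "symmetric_mat (- M) \<longleftrightarrow> symmetric_mat M"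
  by (auto simp: symmetric_mat_def transpose_uminus)

lemma symmetric_zero_mat [simp]: "symmetric_mat (0\<^sub>m a a)"
  by (simp add: symmetric_mat_def)

section \<open>Rational matrices\<close>

interpretation const_fract: comm_ring_hom "\<lambda>c :: real. to_fract [:c:]"
  by unfold_locales (auto simp: to_fract_def[symmetric] one_pCons[symmetric] simp flip: to_fract_mult to_fract_add)

interpretation to_fract_hom: comm_ring_hom "to_fract :: real poly \<Rightarrow> real poly fract"
  by unfold_locales auto

lemma dim_const_ratmat [simp]:
  "dim_row (const_ratmat M) = dim_row M" "dim_col (const_ratmat M) = dim_col M"
  by (auto simp: const_ratmat_def)

lemma const_ratmat_mult:
  assumes "dim_col M = dim_row K"
  shows "const_ratmat (M * K) = const_ratmat M * const_ratmat K"
  unfolding const_ratmat_def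
  by (rule const_fract.mat_hom_mult[of _ "dim_row M" "dim_row K" _ "dim_col K"]) (use assms in auto)

lemma const_ratmat_one: "const_ratmat (1\<^sub>m n) = 1\<^sub>m n"
  unfolding const_ratmat_def by (rule const_fract.mat_hom_one)

lemma const_ratmat_transpose: "const_ratmat M\<^sup>T = (const_ratmat M)\<^sup>T"
  by (rule eq_matI) (auto simp: const_ratmat_def)

lemma symmetric_const_ratmat: "symmetric_mat M \<Longrightarrow> symmetric_mat (const_ratmat M)"
  unfolding symmetric_mat_def const_ratmat_transpose[symmetric] by simp

lemma dim_pencil [simp]:
  "dim_row (pencil E A) = dim_row A" "dim_col (pencil E A) = dim_col A"
  by (auto simp: pencil_def)

lemma symmetric_pencil:
  assumes "symmetric_mat E" "symmetric_mat A" "dim_row E = dim_row A"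
  shows "symmetric_mat (pencil E A)"
proof (unfold symmetric_mat_def, rule eq_matI)
  note d = symmetric_mat_square[OF assms(1)] symmetric_mat_square[OF assms(2)]
  have s: "E $$ (j, i) = E $$ (i, j)" "A $$ (j, i) = A $$ (i, j)"
    if "i < dim_row A" "j < dim_row A" for i j
    using that assms d unfolding symmetric_mat_def
    by (metis index_transpose_mat(1))+
  fix i j assume "i < dim_row (pencil E A)" "j < dim_col (pencil E A)"
  thus "(pencil E A)\<^sup>T $$ (i, j) = pencil E A $$ (i, j)"
    using d assms(3) s[of i j] by (simp add: pencil_def const_ratmat_def)
qed (use symmetric_mat_square[OF assms(2)] in auto)

text \<open>The determinant of \<open>s I - M\<close> is the characteristic polynomial of \<open>M\<close>, which is monic.\<close>

lemma det_monic_pencil: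
  assumes M: "M \<in> carrier_mat k k"
  shows "det (pencil (1\<^sub>m k) M) \<noteq> 0"
proof -
  have "pencil (1\<^sub>m k) M = map_mat to_fract (char_poly_matrix M)"
    using M
    by (intro eq_matI)
      (auto simp: pencil_def const_ratmat_def char_poly_matrix_def simp flip: to_fract_mult to_fract_diff)
  hence "det (pencil (1\<^sub>m k) M) = to_fract (char_poly M)"
    by (simp add: to_fract_hom.hom_det char_poly_def)
  with degree_monic_char_poly[OF M] show ?thesis by auto
qed

text \<open>Multiplication by \<open>R = S\<^sup>-\<^sup>1\<close> turns \<open>s S - M\<close> into the monic pencil \<open>s I - R M\<close>.\<close>

lemma det_pencil_nonzero:
  assumes "S \<in> carrier_mat k k" "M \<in> carrier_mat k k" "R \<in> carrier_mat k k" and R: "R * S = 1\<^sub>m k"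
  shows "det (pencil S M) \<noteq> 0"
proof -
  have c: "const_ratmat R \<in> carrier_mat k k" "pencil S M \<in> carrier_mat k k"
    using assms by (auto intro!: carrier_matI)
  have "const_ratmat R * pencil S M
      = const_ratmat R * (to_fract [:0, 1:] \<cdot>\<^sub>m const_ratmat S) - const_ratmat R * const_ratmat M"
    unfolding pencil_def using assms
    by (intro mult_minus_distrib_mat[of _ k k _ k]) (auto intro: carrier_matI)
  also have "const_ratmat R * (to_fract [:0, 1:] \<cdot>\<^sub>m const_ratmat S)
      = to_fract [:0, 1:] \<cdot>\<^sub>m (const_ratmat R * const_ratmat S)"
    using assms by (intro mult_smult_distrib[of _ k k _ k]) (auto intro: carrier_matI)
  finally have "const_ratmat R * pencil S M = pencil (R * S) (R * M)"
    unfolding pencil_def using assms(1-3) by (simp add: const_ratmat_mult)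
  hence "det (const_ratmat R) * det (pencil S M) = det (pencil (1\<^sub>m k) (R * M))"
    using det_mult[OF c] R by simp
  with det_monic_pencil[of "R * M" k] assms show ?thesis by auto
qed


section \<open>Signatures and reciprocity\<close>

definition signature_mat :: "nat \<Rightarrow> real mat \<Rightarrow> bool" where
  "signature_mat m T \<longleftrightarrow> T \<in> carrier_mat m m \<and> symmetric_mat T \<and> T * T = 1\<^sub>m m"

lemma signature_mat_diag:
  assumes "\<And>i. i < m \<Longrightarrow> t i * t i = 1"
  shows "signature_mat m (mat_diag m t)"
proof -
  have "mat_diag m (\<lambda>i. t i * t i) = 1\<^sub>m m"
    by (rule eq_matI) (use assms in \<open>auto simp: mat_diag_def\<close>)
  thus ?thesis by (simp add: signature_mat_def symmetric_mat_def)
qed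

text \<open>The sign is \<open>1\<close> at a current port and \<open>- 1\<close> at a voltage port; the hybrid form lists its
  current ports first.\<close>

fun port_sign :: "port_form \<Rightarrow> nat \<Rightarrow> nat \<Rightarrow> real" where
  "port_sign Impedance m i = 1"
| "port_sign Admittance m i = - 1"
| "port_sign Hybrid m i = (if i < m div 2 then 1 else - 1)"

lemma port_sign_square: "port_sign form m i * port_sign form m i = 1"
  by (cases form) auto

lemma const_ratmat_diag: "const_ratmat (mat_diag m t) = mat_diag m (\<lambda>i. to_fract [:t i:])"
  by (rule eq_matI) (auto simp: const_ratmat_def mat_diag_def)

lemma symmetric_mat_diag_mult_iff:
  assumes G: "G \<in> carrier_mat m m"
  shows "symmetric_mat (mat_diag m t * G) \<longleftrightarrow>
    (\<forall>i<m. \<forall>j<m. t i * G $$ (i, j) = t j * G $$ (j, i))"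
proof
  assume s: "symmetric_mat (mat_diag m t * G)"
  show "\<forall>i<m. \<forall>j<m. t i * G $$ (i, j) = t j * G $$ (j, i)"
  proof (intro allI impI)
    fix i j assume ij: "i < m" "j < m"
    from s have "(mat_diag m t * G)\<^sup>T $$ (j, i) = (mat_diag m t * G) $$ (j, i)"
      by (simp add: symmetric_mat_def)
    with ij G show "t i * G $$ (i, j) = t j * G $$ (j, i)"
      by (simp add: mat_diag_mult_left[OF G])
  qed
next
  assume "\<forall>i<m. \<forall>j<m. t i * G $$ (i, j) = t j * G $$ (j, i)"
  thus "symmetric_mat (mat_diag m t * G)"
    unfolding symmetric_mat_def mat_diag_mult_left[OF G] by (auto intro!: eq_matI)
qed

text \<open>The signs are constant in the impedance and admittance forms and cancel from the symmetry
  of \<open>T G\<close>. In the hybrid form \<open>T = diag (I, - I)\<close>, so entries within a diagonal block are compared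
  with equal signs and entries of the two off-diagonal blocks with opposite signs, which is block
  skew symmetry.\<close>

lemma reciprocal_if_signed_symmetric:
  assumes G: "G \<in> carrier_mat m m"
    and sym: "symmetric_mat (const_ratmat (mat_diag m (port_sign form m)) * G)"
    and even: "form = Hybrid \<longrightarrow> even m"
  shows "(form = Impedance \<longrightarrow> symmetric_mat G)
       \<and> (form = Admittance \<longrightarrow> symmetric_mat G)
       \<and> (form = Hybrid \<longrightarrow> block_skew_symmetric_mat G)"
proof -
  have signs: "to_fract [:1 :: real:] = 1" "to_fract [:- 1 :: real:] = - 1"
    using const_fract.hom_one const_fract.hom_uminus[of 1] by simp_all
  have e: "to_fract [:port_sign form m i:] * G $$ (i, j) = to_fract [:port_sign form m j:] * G $$ (j, i)"
    if "i < m" "j < m" for i j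
    using sym that unfolding const_ratmat_diag symmetric_mat_diag_mult_iff[OF G] by blast
  have "symmetric_mat G" if "form = Impedance \<or> form = Admittance"
    unfolding symmetric_mat_def
  proof (rule eq_matI)
    fix i j assume "i < dim_row G" "j < dim_col G"
    with e[of i j] that G signs show "G\<^sup>T $$ (i, j) = G $$ (i, j)" by auto
  qed (use G in auto)
  moreover have "block_skew_symmetric_mat G" if h: "form = Hybrid"
  proof -
    define p where "p = m div 2"
    have m: "m = p + p" using even h by (auto simp: p_def)
    have e: "(if i < p then 1 else - 1) * G $$ (i, j) = (if j < p then 1 else - 1) * G $$ (j, i)"
      if "i < m" "j < m" for i j
      using e[OF that] unfolding h port_sign.simps p_def[symmetric] by (auto simp: signs)
    have d: "dim_row G = p + p" "dim_col G = p + p" using G m by auto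
    have e11: "G $$ (i, j) = G $$ (j, i)" if "i < p" "j < p" for i j
      using e[of i j] that m by auto
    have e22: "G $$ (i + p, j + p) = G $$ (j + p, i + p)" if "i < p" "j < p" for i j
      using e[of "i + p" "j + p"] that m by auto
    have e12: "G $$ (i, j + p) = - G $$ (j + p, i)" if "i < p" "j < p" for i j
      using e[of i "j + p"] that m by auto
    show ?thesis
      unfolding block_skew_symmetric_mat_def split_block_def
      using e11 e22 e12 by (auto simp: d Let_def intro!: eq_matI)
  qed
  ultimately show ?thesis by blast
qed

section \<open>The network equations\<close>

lemma incidence_mat_carrier: "incidence_mat a b M \<Longrightarrow> M \<in> carrier_mat a b"
  by (simp add: incidence_mat_def)

context
  fixes form m N
  assumes network: "passive_rlc_network form m N"
begin

lemma network_dims: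
  shows "dim_col (inductance N) = dim_row (inductance N)"
    "dim_row (inc_L N) = nodes N" "dim_col (inc_L N) = dim_row (inductance N)"
    "dim_row (nodal_conductance N) = nodes N" "dim_col (nodal_conductance N) = nodes N"
    "dim_row (nodal_capacitance N) = nodes N" "dim_col (nodal_capacitance N) = nodes N"
    "dim_row (inc_V N) = nodes N"
proof -
  have c: "incidence_mat (nodes N) (dim_row (conductance N)) (inc_G N)"
    "incidence_mat (nodes N) (dim_row (inductance N)) (inc_L N)"
    "incidence_mat (nodes N) (dim_row (capacitance N)) (inc_C N)"
    "symmetric_mat (inductance N)"
    using network by (auto simp: passive_rlc_network_def psd_mat_def)
  show "dim_col (inductance N) = dim_row (inductance N)"
    using symmetric_mat_square[OF c(4)] by simp
  show "dim_row (inc_V N) = nodes N"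
    using network by (cases form) (auto simp: passive_rlc_network_def dest: incidence_mat_carrier)
  show "dim_row (inc_L N) = nodes N" "dim_col (inc_L N) = dim_row (inductance N)"
    using incidence_mat_carrier[OF c(2)] by auto
  show "dim_row (nodal_conductance N) = nodes N" "dim_col (nodal_conductance N) = nodes N"
    "dim_row (nodal_capacitance N) = nodes N" "dim_col (nodal_capacitance N) = nodes N"
    using incidence_mat_carrier[OF c(1)] incidence_mat_carrier[OF c(3)]
    by (auto simp: nodal_conductance_def nodal_capacitance_def)
qed

lemma network_source_dims:
  shows "form = Impedance \<Longrightarrow> dim_row (inc_I N) = nodes N \<and> dim_col (inc_I N) = m"
    "form = Admittance \<Longrightarrow> dim_col (inc_V N) = m"
    "form = Hybrid \<Longrightarrow> dim_row (inc_I N) = nodes N \<and> dim_col (inc_I N) = m div 2 \<and>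
      dim_col (inc_V N) = m div 2 \<and> even m"
proof -
  show "dim_row (inc_I N) = nodes N \<and> dim_col (inc_I N) = m" if f: "form = Impedance"
  proof -
    have "incidence_mat (nodes N) m (inc_I N)"
      using network unfolding passive_rlc_network_def f by simp
    from incidence_mat_carrier[OF this] show ?thesis by auto
  qed
  show "dim_col (inc_V N) = m" if f: "form = Admittance"
  proof -
    have "incidence_mat (nodes N) m (inc_V N)"
      using network unfolding passive_rlc_network_def f by simp
    from incidence_mat_carrier[OF this] show ?thesis by auto
  qed
  show "dim_row (inc_I N) = nodes N \<and> dim_col (inc_I N) = m div 2 \<and>
      dim_col (inc_V N) = m div 2 \<and> even m" if f: "form = Hybrid"
  proof -
    have "incidence_mat (nodes N) (m div 2) (inc_I N)" "incidence_mat (nodes N) (m div 2) (inc_V N)"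
      "even m"
      using network unfolding passive_rlc_network_def f by simp_all
    thus ?thesis by (auto dest: incidence_mat_carrier)
  qed
qed

lemma symmetric_nodal_conductance: "symmetric_mat (nodal_conductance N)"
proof -
  have "symmetric_mat (conductance N)"
    and "incidence_mat (nodes N) (dim_row (conductance N)) (inc_G N)"
    using network by (auto simp: passive_rlc_network_def psd_mat_def)
  thus ?thesis
    unfolding nodal_conductance_def by (intro symmetric_congruence) (auto dest: incidence_mat_carrier)
qed

lemma dim_rlc_A:
  "dim_row (rlc_A N) = nodes N + dim_row (inductance N)"
  "dim_col (rlc_A N) = nodes N + dim_row (inductance N)"
  by (simp_all add: rlc_A_def Let_def network_dims)

lemma symmetric_rlc_A: "symmetric_mat (rlc_A N)"
proof -
  let ?l = "dim_row (inductance N)"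
  have "- nodal_conductance N \<in> carrier_mat (nodes N) (nodes N)"
    "- inc_L N \<in> carrier_mat (nodes N) ?l" "- (inc_L N)\<^sup>T \<in> carrier_mat ?l (nodes N)"
    by (rule carrier_matI; simp add: network_dims)+
  thus ?thesis
    unfolding rlc_A_def Let_def
    by (subst symmetric_four_block_mat_iff[of _ "nodes N" _ ?l])
      (simp_all add: symmetric_nodal_conductance transpose_uminus)
qed

lemma symmetric_rlcv_A: "symmetric_mat (rlcv_A N)"
proof -
  let ?l = "dim_row (inductance N)" and ?v = "dim_col (inc_V N)"
  have "(- inc_V N @\<^sub>r 0\<^sub>m ?l ?v)\<^sup>T = - (inc_V N)\<^sup>T @\<^sub>c 0\<^sub>m ?v ?l"
    by (simp add: append_rows_transpose transpose_uminus)
  moreover have "- inc_V N @\<^sub>r 0\<^sub>m ?l ?v \<in> carrier_mat (nodes N + ?l) ?v"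
    "- (inc_V N)\<^sup>T @\<^sub>c 0\<^sub>m ?v ?l \<in> carrier_mat ?v (nodes N + ?l)"
    by (rule carrier_matI; simp add: append_rows_def append_cols_def network_dims)+
  moreover have "rlc_A N \<in> carrier_mat (nodes N + ?l) (nodes N + ?l)"
    by (rule carrier_matI) (simp_all add: dim_rlc_A)
  ultimately show ?thesis
    unfolding rlcv_A_def Let_def
    by (subst symmetric_four_block_mat_iff[of _ "nodes N + ?l" _ ?v])
      (simp_all add: symmetric_rlc_A)
qed

lemma symmetric_descr_A: "symmetric_mat (descr_A form N)"
  using symmetric_rlc_A symmetric_rlcv_A by (cases form) auto

lemma descr_A_carrier:
  "descr_A form N \<in> carrier_mat (dim_row (descr_E form N)) (dim_row (descr_E form N))"
  by (rule carrier_matI; cases form;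
      simp add: rlcv_A_def rlcv_E_def rlc_E_def Let_def dim_rlc_A network_dims)

lemma descr_B_carrier: "descr_B form m N \<in> carrier_mat (dim_row (descr_E form N)) m"
proof (rule carrier_matI)
  show "dim_row (descr_B form m N) = dim_row (descr_E form N)"
    by (cases form) (simp_all add: network_source_dims rlcv_E_def rlc_E_def append_rows_def
        append_cols_def Let_def network_dims)
  show "dim_col (descr_B form m N) = m"
    by (cases form) (simp_all add: network_source_dims append_rows_def append_cols_def Let_def
        flip: mult_2)
qed

text \<open>A current source enters \<open>B\<^sub>0\<close> and \<open>C\<^sub>0\<close> through the same block \<open>- A\<^sub>I\<close>, whereas a voltage
  source enters them through identity blocks of opposite sign. These are the port signs.\<close>

lemma descr_C_eq:
  "descr_C form m N = mat_diag m (port_sign form m) * (descr_B form m N)\<^sup>T"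
proof (cases form)
  case Impedance
  have "mat_diag m (port_sign Impedance m) = 1\<^sub>m m"
    by (rule eq_matI) (auto simp: mat_diag_def)
  moreover have "(descr_B Impedance m N)\<^sup>T \<in> carrier_mat m (dim_row (descr_E form N))"
    using descr_B_carrier Impedance by simp
  ultimately show ?thesis using Impedance by simp
next
  case Admittance
  have "(descr_B form m N)\<^sup>T \<in> carrier_mat m (dim_row (descr_E form N))"
    using descr_B_carrier by simp
  from mat_diag_mult_left[OF this] show ?thesis
    unfolding Admittance
    by (auto simp: append_rows_def append_cols_def rlcv_E_def rlc_E_def Let_def
        network_dims network_source_dims(2)[OF Admittance] intro!: eq_matI)
next
  case Hybrid
  define h where "h = m div 2"
  from network_source_dims(3)[OF Hybrid] have d: "dim_row (inc_I N) = nodes N"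
    "dim_col (inc_I N) = h" "dim_col (inc_V N) = h" and m: "m = h + h"
    by (auto simp: h_def)
  have "(descr_B form m N)\<^sup>T \<in> carrier_mat m (dim_row (descr_E form N))"
    using descr_B_carrier by simp
  from mat_diag_mult_left[OF this] show ?thesis
    unfolding Hybrid descr_B.simps descr_C.simps port_sign.simps h_def[symmetric] Let_def
    by (auto simp: m append_rows_def append_cols_def rlcv_E_def rlc_E_def Let_def
        network_dims d intro!: eq_matI)
qed

end

section \<open>Index reduction and truncation\<close>

text \<open>Congruence with \<open>R\<close> preserves \<open>A\<^sub>0\<^sup>T = A\<^sub>0\<close> and \<open>C\<^sub>0 = T B\<^sub>0\<^sup>T\<close>. Read blockwise, these say
  that \<open>A\<^sub>1\<^sub>1\<close> and \<open>A\<^sub>2\<^sub>2\<close> are symmetric, \<open>A\<^sub>2\<^sub>1 = A\<^sub>1\<^sub>2\<^sup>T\<close> and \<open>C\<^sub>i = T B\<^sub>i\<^sup>T\<close>. Substituting them, every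
  Schur complement term takes, up to a factor \<open>T\<close>, the form \<open>Z\<^sup>T A\<^sub>2\<^sub>2\<^sup>-\<^sup>1 Y\<close>, with \<open>Z = Y\<close> for the state and feedthrough
  matrices.\<close>

lemma schur_reduction_signed_symmetric:
  assumes T: "signature_mat m T"
    and A0: "symmetric_mat A0" "A0 \<in> carrier_mat n n"
    and B0: "B0 \<in> carrier_mat n m"
    and C0: "C0 = T * B0\<^sup>T"
    and R: "R \<in> carrier_mat n n"
    and A: "R * A0 * R\<^sup>T = four_block_mat A11 A12 A21 A22"
      "A11 \<in> carrier_mat r r" "A12 \<in> carrier_mat r p"
      "A21 \<in> carrier_mat p r" "A22 \<in> carrier_mat p p"
    and B: "R * B0 = B1 @\<^sub>r B2" "B1 \<in> carrier_mat r m" "B2 \<in> carrier_mat p m"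
    and C: "C0 * R\<^sup>T = C1 @\<^sub>c C2" "C1 \<in> carrier_mat m r" "C2 \<in> carrier_mat m p"
    and det: "det A22 \<noteq> 0"
  shows "symmetric_mat (A11 - A12 * inv_mat A22 * A21)"
    and "C1 - C2 * inv_mat A22 * A21 = T * (B1 - A12 * inv_mat A22 * B2)\<^sup>T"
    and "symmetric_mat (T * - (C2 * inv_mat A22 * B2))"
proof -
  have "symmetric_mat (four_block_mat A11 A12 A21 A22)"
    unfolding A(1)[symmetric] by (rule symmetric_congruence[OF A0(1)]) (use A0(2) R in auto)
  hence s: "symmetric_mat A11" "symmetric_mat A22" and A21: "A21 = A12\<^sup>T"
    unfolding symmetric_four_block_mat_iff[OF A(2-5)] by auto
  let ?P = "inv_mat A22"
  have P: "?P \<in> carrier_mat p p" using inv_mat_of_det_nonzero(1)[OF A(5) det] .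
  have sP: "?P\<^sup>T = ?P" using symmetric_inv_mat[OF A(5) det s(2)] by (simp add: symmetric_mat_def)
  have Tc: "T \<in> carrier_mat m m" "T * T = 1\<^sub>m m" using T by (auto simp: signature_mat_def)
  note dims = carrier_matD[OF P] carrier_matD[OF A(2)] carrier_matD[OF A(3)] carrier_matD[OF B(2)]
    carrier_matD[OF B(3)] carrier_matD[OF Tc(1)] carrier_matD[OF R] carrier_matD[OF B0]
  have "C1 @\<^sub>c C2 = T * (R * B0)\<^sup>T"
    unfolding C(1)[symmetric] C0 using dims by (simp add: transpose_mult_dim mult_assoc_dim)
  also have "\<dots> = (T * B1\<^sup>T) @\<^sub>c (T * B2\<^sup>T)"
    unfolding B(1) using dims by (simp add: append_rows_transpose mult_append_cols)
  finally have C12: "C1 @\<^sub>c C2 = (T * B1\<^sup>T) @\<^sub>c (T * B2\<^sup>T)" .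
  have "T * B1\<^sup>T \<in> carrier_mat m r" "T * B2\<^sup>T \<in> carrier_mat m p"
    using Tc(1) B(2,3) by simp_all
  note C12 = append_cols_inject[OF C12 C(2,3) this]
  from C12(1) have C1: "C1 = T * B1\<^sup>T" .
  from C12(2) have C2: "C2 = T * B2\<^sup>T" .
  have K: "A12 * ?P * A12\<^sup>T \<in> carrier_mat r r" using dims by (auto intro!: carrier_matI)
  have "symmetric_mat (A12 * ?P * A12\<^sup>T)"
    by (rule symmetric_congruence) (use sP dims in \<open>auto simp: symmetric_mat_def\<close>)
  thus "symmetric_mat (A11 - A12 * ?P * A21)"
    using s(1) unfolding A21 symmetric_mat_def by (simp add: transpose_minus[OF A(2) K])
  have L: "A12 * ?P * B2 \<in> carrier_mat r m" using dims by (auto intro!: carrier_matI)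
  have "T * (B1 - A12 * ?P * B2)\<^sup>T = T * B1\<^sup>T - T * (A12 * ?P * B2)\<^sup>T"
    unfolding transpose_minus[OF B(2) L]
    using B(2) L Tc by (intro mult_minus_distrib_mat[of _ m m _ r]) auto
  also have "\<dots> = C1 - C2 * ?P * A21"
    unfolding C1 C2 A21 using dims sP by (simp add: transpose_mult_dim mult_assoc_dim)
  finally show "C1 - C2 * ?P * A21 = T * (B1 - A12 * ?P * B2)\<^sup>T" ..
  have "T * - (C2 * ?P * B2) = - ((T * T) * (B2\<^sup>T * ?P * B2))"
    unfolding C2 using dims by (simp add: mult_assoc_dim)
  also have "\<dots> = - (B2\<^sup>T * ?P * B2\<^sup>T\<^sup>T)"
    unfolding Tc(2) using dims by simp
  finally have eq: "T * - (C2 * ?P * B2) = - (B2\<^sup>T * ?P * B2\<^sup>T\<^sup>T)" .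
  have "symmetric_mat (B2\<^sup>T * ?P * B2\<^sup>T\<^sup>T)"
    by (rule symmetric_congruence) (use sP dims in \<open>auto simp: symmetric_mat_def\<close>)
  thus "symmetric_mat (T * - (C2 * ?P * B2))" unfolding eq by (simp only: symmetric_uminus_iff)
qed

text \<open>The symmetric pencil \<open>s S - A\<close> has a symmetric inverse \<open>P\<close>. As \<open>C S = T B\<^sup>T\<close> and \<open>T T = I\<close>,
  the sign matrix cancels: \<open>T C S P B = B\<^sup>T P B\<close>.\<close>

lemma signed_symmetric_transfer:
  assumes T: "signature_mat m T"
    and S: "signature_mat k S"
    and A: "symmetric_mat A" "A \<in> carrier_mat k k"
    and B: "B \<in> carrier_mat k m"
    and C: "C \<in> carrier_mat m k" "C * S = T * B\<^sup>T"
    and D: "D \<in> carrier_mat m m" "symmetric_mat (T * D)"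
    and G: "G = const_ratmat C * const_ratmat S * inv_mat (pencil S A) * const_ratmat B
      + const_ratmat D"
  shows "G \<in> carrier_mat m m" "symmetric_mat (const_ratmat T * G)"
proof -
  let ?P = "inv_mat (pencil S A)" and ?B = "const_ratmat B" and ?T = "const_ratmat T"
  have Tc: "T \<in> carrier_mat m m" "T * T = 1\<^sub>m m" using T by (auto simp: signature_mat_def)
  have Sc: "S \<in> carrier_mat k k" "symmetric_mat S" "S * S = 1\<^sub>m k"
    using S by (auto simp: signature_mat_def)
  have det: "det (pencil S A) \<noteq> 0" using det_pencil_nonzero[OF Sc(1) A(2) Sc(1,3)] .
  have pc: "pencil S A \<in> carrier_mat k k" using A(2) by (auto intro!: carrier_matI)
  have P: "?P \<in> carrier_mat k k" using inv_mat_of_det_nonzero(1)[OF pc det] .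
  have sP: "symmetric_mat ?P"
    by (rule symmetric_inv_mat[OF pc det symmetric_pencil]) (use Sc A in auto)
  note dims = carrier_matD[OF P] carrier_matD[OF B] carrier_matD[OF D(1)]
    carrier_matD[OF Tc(1)] carrier_matD[OF Sc(1)] carrier_matD[OF C(1)]
  show "G \<in> carrier_mat m m" unfolding G using dims by (auto intro!: carrier_matI)
  have TT: "?T * ?T = 1\<^sub>m m"
    using const_ratmat_mult[of T T] dims Tc(2) by (simp add: const_ratmat_one)
  have "const_ratmat C * const_ratmat S = ?T * ?B\<^sup>T"
    using arg_cong[OF C(2), of const_ratmat] dims by (simp add: const_ratmat_mult const_ratmat_transpose)
  hence "?T * G = ?T * (?T * ?B\<^sup>T * ?P * ?B + const_ratmat D)" unfolding G by simp
  also have "\<dots> = ?T * (?T * ?B\<^sup>T * ?P * ?B) + ?T * const_ratmat D"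
    using dims by (intro mult_add_distrib_mat[of _ m m _ m]) (auto intro!: carrier_matI)
  also have "?T * (?T * ?B\<^sup>T * ?P * ?B) = (?T * ?T) * (?B\<^sup>T * ?P * ?B)"
    using dims by (simp add: mult_assoc_dim)
  also have "\<dots> = ?B\<^sup>T * ?P * ?B\<^sup>T\<^sup>T"
    unfolding TT using dims by simp
  also have "?T * const_ratmat D = const_ratmat (T * D)"
    using dims by (simp add: const_ratmat_mult)
  finally have TG: "?T * G = ?B\<^sup>T * ?P * ?B\<^sup>T\<^sup>T + const_ratmat (T * D)" .
  have "symmetric_mat (?B\<^sup>T * ?P * ?B\<^sup>T\<^sup>T)" by (rule symmetric_congruence[OF sP]) (use dims in simp)
  moreover have "symmetric_mat (const_ratmat (T * D))" using D(2) by (rule symmetric_const_ratmat)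
  moreover have "(?B\<^sup>T * ?P * ?B\<^sup>T\<^sup>T + const_ratmat (T * D))\<^sup>T
      = (?B\<^sup>T * ?P * ?B\<^sup>T\<^sup>T)\<^sup>T + (const_ratmat (T * D))\<^sup>T"
    by (rule transpose_add[of _ m m]) (use dims in \<open>auto intro!: carrier_matI\<close>)
  ultimately show "symmetric_mat (?T * G)" unfolding TG by (simp add: symmetric_mat_def)
qed

theorem theorem3p2:
  fixes form :: port_form and N :: rlc
    and n m r1 r2 r q k :: nat
    and E0 A0 B0 C0 V I' A11 A12 A21 A22 B1 B2 C1 C2 :: "real mat"
    and As Ahat Bhat Chat Dhat D A B C X Q U U1 U2 S1 W As_red B1_red C1_red :: "real mat"
    and \<sigma> :: "nat \<Rightarrow> real"
    and G :: "real poly fract mat"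
  assumes network: "passive_rlc_network form m N"
    and system: "E0 = descr_E form N" "A0 = descr_A form N"
      "B0 = descr_B form m N" "C0 = descr_C form m N"
    and n: "n = dim_row E0"
    and regular: "regular_pencil E0 A0"
    and ranks: "r1 = vec_space.rank (nodes N) (nodal_capacitance N)"
      "r2 = vec_space.rank (dim_row (inductance N)) (inductance N)"
      "r = r1 + r2"
    and I': "I' = mat_diag r (\<lambda>i. if i < r1 then 1 else - 1)"
    and V: "V \<in> carrier_mat n n" "invertible_mat V"
      "E0 = V * four_block_mat I' (0\<^sub>m r (n - r)) (0\<^sub>m (n - r) r) (0\<^sub>m (n - r) (n - r)) * V\<^sup>T"
    and A0_blocks: "inv_mat V * A0 * (inv_mat V)\<^sup>T = four_block_mat A11 A12 A21 A22"
      "A11 \<in> carrier_mat r r" "A12 \<in> carrier_mat r (n - r)"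
      "A21 \<in> carrier_mat (n - r) r" "A22 \<in> carrier_mat (n - r) (n - r)"
    and B0_blocks: "inv_mat V * B0 = B1 @\<^sub>r B2"
      "B1 \<in> carrier_mat r m" "B2 \<in> carrier_mat (n - r) m"
    and C0_blocks: "C0 * (inv_mat V)\<^sup>T = C1 @\<^sub>c C2"
      "C1 \<in> carrier_mat m r" "C2 \<in> carrier_mat m (n - r)"
    and index1: "invertible_mat A22"
    and As: "As = A11 - A12 * inv_mat A22 * A21"
    and Ahat: "Ahat = I' * As"
    and Bhat: "Bhat = I' * (B1 - A12 * inv_mat A22 * B2)"
    and Chat: "Chat = C1 - C2 * inv_mat A22 * A21"
    and Dhat: "Dhat = - (C2 * inv_mat A22 * B2)"
    and Dhat_pd: "pd_mat (Dhat + Dhat\<^sup>T)"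
    and D: "D \<in> carrier_mat m m" "D * D\<^sup>T = inv_mat (Dhat + Dhat\<^sup>T)"
    and B: "B = Bhat * D"
    and C: "C = D\<^sup>T * Chat"
    and A: "A = Ahat - B * C"
    and X: "X \<in> carrier_mat r r" "psd_mat X"
      "A\<^sup>T * X + X * A + X * B * B\<^sup>T * X + C\<^sup>T * C = 0\<^sub>m r r"
    and Q: "Q \<in> carrier_mat r q" "X = Q * Q\<^sup>T"
    and U: "U \<in> carrier_mat q q" "U\<^sup>T * U = 1\<^sub>m q"
    and eig: "Q\<^sup>T * I' * Q = U * mat_diag q \<sigma> * U\<^sup>T"
    and descending: "\<And>i j. i \<le> j \<Longrightarrow> j < q \<Longrightarrow> \<bar>\<sigma> j\<bar> \<le> \<bar>\<sigma> i\<bar>"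
    and U_blocks: "U = U1 @\<^sub>c U2" "U1 \<in> carrier_mat q k" "U2 \<in> carrier_mat q (q - k)"
    and retained: "k \<le> q" "\<And>i. i < k \<Longrightarrow> \<sigma> i \<noteq> 0"
    and S1: "S1 = mat_diag k (\<lambda>i. sgn (\<sigma> i))"
    and W: "W = mat_diag k (\<lambda>i. \<bar>\<sigma> i\<bar> powr (- 1 / 2))"
    and As_red: "As_red = W * U1\<^sup>T * Q\<^sup>T * I' * As * I' * Q * U1 * W"
    and B1_red: "B1_red = W * U1\<^sup>T * Q\<^sup>T * Bhat"
    and C1_red: "C1_red = Chat * I' * Q * U1 * S1 * W"
    and G: "G = const_ratmat C1_red * const_ratmat S1 * inv_mat (pencil S1 As_red)
              * const_ratmat B1_red + const_ratmat Dhat"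
  shows "(form = Impedance \<longrightarrow> symmetric_mat G)
       \<and> (form = Admittance \<longrightarrow> symmetric_mat G)
       \<and> (form = Hybrid \<longrightarrow> block_skew_symmetric_mat G)"
proof -
  define T where "T = mat_diag m (port_sign form m)"
  define K where "K = B1 - A12 * inv_mat A22 * B2"
  define M where "M = Q * U1 * W"
  have T: "signature_mat m T"
    unfolding T_def by (rule signature_mat_diag) (rule port_sign_square)
  have I'_sig: "signature_mat r I'"
    unfolding I' by (rule signature_mat_diag) auto
  have S1_sig: "signature_mat k S1"
    unfolding S1 by (rule signature_mat_diag) (use retained(2) in \<open>auto simp: sgn_if\<close>)
  have R: "inv_mat V \<in> carrier_mat n n"
    using inv_mat_of_det_nonzero(1)[OF V(1) invertible_mat_det_nonzero[OF V(1,2)]] .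
  note reduction = schur_reduction_signed_symmetric[OF T _ _ _ _ R A0_blocks B0_blocks C0_blocks
      invertible_mat_det_nonzero[OF A0_blocks(5) index1]]
  have A0_sym: "symmetric_mat A0" and A0: "A0 \<in> carrier_mat n n" and B0: "B0 \<in> carrier_mat n m"
    and C0: "C0 = T * B0\<^sup>T"
    using symmetric_descr_A[OF network] descr_A_carrier[OF network] descr_B_carrier[OF network]
      descr_C_eq[OF network] by (auto simp: system n T_def)
  have As_sym: "symmetric_mat As" and Chat_eq: "Chat = T * K\<^sup>T" and Dhat_sym: "symmetric_mat (T * Dhat)"
    using reduction[OF A0_sym A0 B0 C0] by (auto simp: As Chat Dhat K_def)
  have P: "inv_mat A22 \<in> carrier_mat (n - r) (n - r)"
    using inv_mat_of_det_nonzero(1)[OF A0_blocks(5) invertible_mat_det_nonzero[OF A0_blocks(5) index1]] .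
  have I'c: "I' \<in> carrier_mat r r" "I'\<^sup>T = I'" "I' * I' = 1\<^sub>m r"
    using I'_sig by (auto simp: signature_mat_def symmetric_mat_def)
  have S1c: "S1 \<in> carrier_mat k k" "S1 * S1 = 1\<^sub>m k" using S1_sig by (auto simp: signature_mat_def)
  have Tc: "T \<in> carrier_mat m m" using T by (simp add: signature_mat_def)
  have Wc: "W \<in> carrier_mat k k" "W\<^sup>T = W" by (auto simp: W)
  have K: "K \<in> carrier_mat r m" using A0_blocks B0_blocks P by (auto simp: K_def)
  have Asc: "As \<in> carrier_mat r r" using A0_blocks P by (auto simp: As intro!: carrier_matI)
  have Dhatc: "Dhat \<in> carrier_mat m m" using C0_blocks B0_blocks P by (auto simp: Dhat intro!: carrier_matI)
  have Bhat_eq: "Bhat = I' * K" by (simp add: Bhat K_def)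
  note dims = carrier_matD[OF I'c(1)] carrier_matD[OF S1c(1)] carrier_matD[OF Tc]
    carrier_matD[OF Wc(1)] carrier_matD[OF K] carrier_matD[OF Asc] carrier_matD[OF Q(1)]
    carrier_matD[OF U_blocks(2)]
  \<comment> \<open>The left factor of \<^term>\<open>As_red\<close> is the transpose of the right one because \<^term>\<open>W\<close>
      and \<^term>\<open>I'\<close> are diagonal.\<close>
  have As_red_eq: "As_red = (M\<^sup>T * I') * As * (M\<^sup>T * I')\<^sup>T"
    unfolding As_red M_def using dims I'c(2) Wc(2) by (simp add: transpose_mult_dim mult_assoc_dim)
  have As_red_sym: "symmetric_mat As_red"
    unfolding As_red_eq by (rule symmetric_congruence[OF As_sym]) (use dims in simp)
  have B1_red_eq: "B1_red = M\<^sup>T * (I' * K)"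
    unfolding B1_red Bhat_eq M_def using dims Wc(2) by (simp add: transpose_mult_dim mult_assoc_dim)
  \<comment> \<open>The diagonal matrices \<^term>\<open>S1\<close> and \<^term>\<open>W\<close> commute, so the two factors \<^term>\<open>S1\<close> around
      \<^term>\<open>W\<close> cancel; one comes from the output matrix, the other from the transfer function.\<close>
  have "S1 * W * S1 = W * (S1 * S1)"
    unfolding S1 W by (simp add: mult.commute mult.left_commute)
  also have "\<dots> = W" using S1c(2) Wc(1) by simp
  finally have "S1 * (W * S1) = W" using dims by (simp add: mult_assoc_dim)
  hence C1_red_eq: "C1_red * S1 = T * B1_red\<^sup>T"
    unfolding C1_red B1_red_eq Chat_eq M_def
    using dims I'c(2) Wc(2) by (simp add: transpose_mult_dim mult_assoc_dim)
  have red_carriers: "As_red \<in> carrier_mat k k" "B1_red \<in> carrier_mat k m" "C1_red \<in> carrier_mat m k"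
    using dims by (auto simp: As_red B1_red_eq C1_red Chat_eq M_def intro!: carrier_matI)
  note transfer = signed_symmetric_transfer[OF T S1_sig As_red_sym red_carriers(1,2,3) C1_red_eq
      Dhatc Dhat_sym G]
  show ?thesis
    by (rule reciprocal_if_signed_symmetric[OF transfer(1) transfer(2)[unfolded T_def]])
      (use network in \<open>auto simp: passive_rlc_network_def\<close>)
qed

end
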